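(* Let $\mathcal{L}$ be a classical propositional language. Given a revision operation $*$ which respects logical equivalence, define $|$ by $M(T)\,|\,M(T'):=M(T*T')$. Conversely, given an operation $|$, define $*$ by $T*T':=Th(M(T)\,|\,M(T'))$. Then: (1.1) If $*$ satisfies $(K*7)$, then the operation $|$ defined from it satisfies $(X|7)$. (1.2) If $|$ satisfies $(X|7)$ and is definability preserving $(\mu dp)$, then the operation $*$ defined from it satisfies $(K*7)$. (1.3) If $|$ satisfies $(X|7)$, then the operation $*$ defined from it satisfies all instances of $(K*7)$ in which the set $B=M(T'')$ is the model set of some single formula $\phi$. (1.4) In general, $(X|7)$ for $|$ does not imply $(K*7)$ for the operation $*$ defined from it. (2.1) If $*$ satisfies $( *Loop)$, then the operation $|$ defined from it satisfies $(|Loop)$. (2.2) If $|$ satisfies $(|Loop)$ and is definability preserving $(\mu dp)$, then the operation $*$ defined from it satisfies $( *Loop)$. (2.3) If $|$ satisfies $(|Loop)$, then the operation $*$ defined from it satisfies all instances of $( *Loop)$ in which every $X_i=M(T_i)$ is the model set of some single formula $\phi_i$. (2.4) In general, $(|Loop)$ for $|$ does not imply $( *Loop)$ for the operation $*$ defined from it. (In (1.4) and (2.4): there exist a language $\mathcal{L}$ and an operation $|$ satisfying the first condition such that the associated $*$ violates the second.)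
   Context: A theory is a set of formulas of $\mathcal{L}$; $\overline{T}$ is the classical deductive closure of $T$; $M_{\mathcal{L}}$ is the set of models of $\mathcal{L}$, $M(T)$ the set of models of $T$; $\boldsymbol{D}_{\mathcal{L}}=\{M(T):T\text{ a theory}\}$; $Th(X)=\{\phi:X\models\phi\}$ for $X\subseteq M_{\mathcal{L}}$; $Con(T,T')$ means that $T\cup T'$ is classically consistent; $T\vee T':=\{\phi\vee\phi':\phi\in T,\phi'\in T'\}$ (so $M(T\vee T')=M(T)\cup M(T')$). A revision operation $*$ assigns a theory $T*T'$ to any two consistent theories $T,T'$ (full theories are allowed on both sides); it respects logical equivalence iff $\overline{T}=\overline{S}$ and $\overline{T'}=\overline{S'}$ imply $T*T'=S*S'$. On the semantic side, $|$ assigns to any two nonempty sets $X,Y\in\boldsymbol{D}_{\mathcal{L}}$ a subset $X|Y\subseteq M_{\mathcal{L}}$; it is definability preserving $(\mu dp)$ iff always $X|Y\in\boldsymbol{D}_{\mathcal{L}}$. Conditions (in the version with full theories; each is required whenever all terms occurring in it are defined): $(K*7)$: $T*(T'\cup T'')\subseteq\overline{(T*T')\cup T''}$ for all theories $T,T',T''$. $(X|7)$: $(X|A)\cap B\subseteq X|(A\cap B)$ for all $X,A,B\in\boldsymbol{D}_{\mathcal{L}}$. $( *Loop)$: for all $k\geq1$ and theories $T_0,\dots,T_k$: if $Con(T_{i-1},\,T_i*(T_{i-1}\vee T_{i+1}))$ for all $1\le i\le k-1$, and $Con(T_{k-1},\,T_k*(T_{k-1}\vee T_0))$, then $Con(T_1,\,T_0*(T_k\vee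 T_1))$. $(|Loop)$: for all $k\geq1$ and $X_0,\dots,X_k\in\boldsymbol{D}_{\mathcal{L}}$: if $(X_i|(X_{i-1}\cup X_{i+1}))\cap X_{i-1}\neq\emptyset$ for all $1\le i\le k-1$, and $(X_k|(X_{k-1}\cup X_0))\cap X_{k-1}\neq\emptyset$, then $(X_0|(X_k\cup X_1))\cap X_1\neq\emptyset$. *)

theory Defs
  imports Main
begin

text \<open>A classical propositional language \<open>\<L>\<close> is given by its type \<open>'v\<close> of propositional variables,
  of arbitrary cardinality.\<close>

datatype 'v form =
    Atom 'v
  | Falsum
  | Neg "'v form"
  | Conj "'v form" "'v form"
  | Disj "'v form" "'v form"
  | Imp "'v form" "'v form"

type_synonym 'v model = "'v \<Rightarrow> bool"

primrec sat :: "'v model \<Rightarrow> 'v form \<Rightarrow> bool" (infix "\<Turnstile>" 50) where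
  "m \<Turnstile> Atom p \<longleftrightarrow> m p"
| "m \<Turnstile> Falsum \<longleftrightarrow> False"
| "m \<Turnstile> Neg \<phi> \<longleftrightarrow> \<not> m \<Turnstile> \<phi>"
| "m \<Turnstile> Conj \<phi> \<psi> \<longleftrightarrow> m \<Turnstile> \<phi> \<and> m \<Turnstile> \<psi>"
| "m \<Turnstile> Disj \<phi> \<psi> \<longleftrightarrow> m \<Turnstile> \<phi> \<or> m \<Turnstile> \<psi>"
| "m \<Turnstile> Imp \<phi> \<psi> \<longleftrightarrow> (m \<Turnstile> \<phi> \<longrightarrow> m \<Turnstile> \<psi>)"

text \<open>Classical derivability: natural deduction from a possibly infinite set of premises.\<close>

inductive derives :: "'v form set \<Rightarrow> 'v form \<Rightarrow> bool" (infix "\<turnstile>" 50) where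
  Assm: "\<phi> \<in> \<Gamma> \<Longrightarrow> \<Gamma> \<turnstile> \<phi>"
| Classical: "insert (Neg \<phi>) \<Gamma> \<turnstile> Falsum \<Longrightarrow> \<Gamma> \<turnstile> \<phi>"
| NegI: "insert \<phi> \<Gamma> \<turnstile> Falsum \<Longrightarrow> \<Gamma> \<turnstile> Neg \<phi>"
| NegE: "\<Gamma> \<turnstile> Neg \<phi> \<Longrightarrow> \<Gamma> \<turnstile> \<phi> \<Longrightarrow> \<Gamma> \<turnstile> Falsum"
| ConjI: "\<Gamma> \<turnstile> \<phi> \<Longrightarrow> \<Gamma> \<turnstile> \<psi> \<Longrightarrow> \<Gamma> \<turnstile> Conj \<phi> \<psi>"
| ConjE1: "\<Gamma> \<turnstile> Conj \<phi> \<psi> \<Longrightarrow> \<Gamma> \<turnstile> \<phi>"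
| ConjE2: "\<Gamma> \<turnstile> Conj \<phi> \<psi> \<Longrightarrow> \<Gamma> \<turnstile> \<psi>"
| DisjI1: "\<Gamma> \<turnstile> \<phi> \<Longrightarrow> \<Gamma> \<turnstile> Disj \<phi> \<psi>"
| DisjI2: "\<Gamma> \<turnstile> \<psi> \<Longrightarrow> \<Gamma> \<turnstile> Disj \<phi> \<psi>"
| DisjE: "\<Gamma> \<turnstile> Disj \<phi> \<psi> \<Longrightarrow> insert \<phi> \<Gamma> \<turnstile> \<chi> \<Longrightarrow> insert \<psi> \<Gamma> \<turnstile> \<chi> \<Longrightarrow> \<Gamma> \<turnstile> \<chi>"
| ImpI: "insert \<phi> \<Gamma> \<turnstile> \<psi> \<Longrightarrow> \<Gamma> \<turnstile> Imp \<phi> \<psi>"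
| ImpE: "\<Gamma> \<turnstile> Imp \<phi> \<psi> \<Longrightarrow> \<Gamma> \<turnstile> \<phi> \<Longrightarrow> \<Gamma> \<turnstile> \<psi>"

definition Cn :: "'v form set \<Rightarrow> 'v form set" where
  "Cn T = {\<phi>. T \<turnstile> \<phi>}"

definition consistent :: "'v form set \<Rightarrow> bool" where
  "consistent T \<longleftrightarrow> \<not> T \<turnstile> Falsum"

definition Con :: "'v form set \<Rightarrow> 'v form set \<Rightarrow> bool" where
  "Con T T' \<longleftrightarrow> consistent (T \<union> T')"

definition Mod :: "'v form set \<Rightarrow> 'v model set" where
  "Mod T = {m. \<forall>\<phi>\<in>T. m \<Turnstile> \<phi>}"

definition Th :: "'v model set \<Rightarrow> 'v form set" where
  "Th X = {\<phi>. \<forall>m\<in>X. m \<Turnstile> \<phi>}"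

definition definable :: "'v model set set" where
  "definable = range Mod"

definition disj_theory :: "'v form set \<Rightarrow> 'v form set \<Rightarrow> 'v form set" where
  "disj_theory T T' = {Disj \<phi> \<phi>' |\<phi> \<phi>'. \<phi> \<in> T \<and> \<phi>' \<in> T'}"

text \<open>Both kinds of operations are partial in the mathematics: \<open>T * T'\<close> is defined for consistent
  \<open>T\<close>, \<open>T'\<close>, and \<open>X | Y\<close> for nonempty \<open>X\<close>, \<open>Y\<close> in \<^const>\<open>definable\<close>. They are total functions here,
  and every condition below refers only to values at such arguments.\<close>

type_synonym 'v revision = "'v form set \<Rightarrow> 'v form set \<Rightarrow> 'v form set"
type_synonym 'v sem_op = "'v model set \<Rightarrow> 'v model set \<Rightarrow> 'v model set"

definition respects_equivalence :: "'v revision \<Rightarrow> bool" where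
  "respects_equivalence star \<longleftrightarrow>
     (\<forall>T T' S S'. consistent T \<longrightarrow> consistent T' \<longrightarrow> consistent S \<longrightarrow> consistent S' \<longrightarrow>
        Cn T = Cn S \<longrightarrow> Cn T' = Cn S' \<longrightarrow> star T T' = star S S')"

definition mu_dp :: "'v sem_op \<Rightarrow> bool" where
  "mu_dp bar \<longleftrightarrow>
     (\<forall>X\<in>definable. \<forall>Y\<in>definable. X \<noteq> {} \<longrightarrow> Y \<noteq> {} \<longrightarrow> bar X Y \<in> definable)"

text \<open>The description picks the common value of \<open>M(T * T')\<close> over all representations \<open>X = M(T)\<close>,
  \<open>Y = M(T')\<close>; it is unique if \<open>*\<close> respects logical equivalence.\<close>

definition bar_of :: "'v revision \<Rightarrow> 'v sem_op" where
  "bar_of star X Y =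
     (THE Z. \<exists>T T'. consistent T \<and> consistent T' \<and> X = Mod T \<and> Y = Mod T' \<and> Z = Mod (star T T'))"

definition star_of :: "'v sem_op \<Rightarrow> 'v revision" where
  "star_of bar T T' = Th (bar (Mod T) (Mod T'))"

definition K7_instance ::
  "'v revision \<Rightarrow> 'v form set \<Rightarrow> 'v form set \<Rightarrow> 'v form set \<Rightarrow> bool" where
  "K7_instance star T T' T'' \<longleftrightarrow>
     (consistent T \<longrightarrow> consistent T' \<longrightarrow> consistent (T' \<union> T'') \<longrightarrow>
        star T (T' \<union> T'') \<subseteq> Cn (star T T' \<union> T''))"

definition K7 :: "'v revision \<Rightarrow> bool" where
  "K7 star \<longleftrightarrow> (\<forall>T T' T''. K7_instance star T T' T'')"

definition X7 :: "'v sem_op \<Rightarrow> bool" where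
  "X7 bar \<longleftrightarrow>
     (\<forall>X\<in>definable. \<forall>A\<in>definable. \<forall>B\<in>definable. X \<noteq> {} \<longrightarrow> A \<noteq> {} \<longrightarrow> A \<inter> B \<noteq> {} \<longrightarrow>
        bar X A \<inter> B \<subseteq> bar X (A \<inter> B))"

text \<open>In the two loop conditions all terms are defined iff all \<open>T\<^sub>i\<close> are consistent, respectively all
  \<open>X\<^sub>i\<close> are nonempty: every \<open>T\<^sub>i\<close> with \<open>i \<le> k\<close> is the left argument of some \<open>*\<close>, and
  \<open>T \<or> T'\<close> is consistent as soon as \<open>T\<close> or \<open>T'\<close> is.\<close>

definition star_Loop_instance :: "'v revision \<Rightarrow> nat \<Rightarrow> (nat \<Rightarrow> 'v form set) \<Rightarrow> bool" where
  "star_Loop_instance star k T \<longleftrightarrow>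
     ((\<forall>i\<le>k. consistent (T i)) \<longrightarrow>
      (\<forall>i. 1 \<le> i \<and> i \<le> k - 1 \<longrightarrow>
         Con (T (i - 1)) (star (T i) (disj_theory (T (i - 1)) (T (i + 1))))) \<longrightarrow>
      Con (T (k - 1)) (star (T k) (disj_theory (T (k - 1)) (T 0))) \<longrightarrow>
      Con (T 1) (star (T 0) (disj_theory (T k) (T 1))))"

definition star_Loop :: "'v revision \<Rightarrow> bool" where
  "star_Loop star \<longleftrightarrow> (\<forall>k\<ge>1. \<forall>T. star_Loop_instance star k T)"

definition bar_Loop :: "'v sem_op \<Rightarrow> bool" where
  "bar_Loop bar \<longleftrightarrow>
     (\<forall>k\<ge>1. \<forall>X :: nat \<Rightarrow> 'v model set.
        (\<forall>i\<le>k. X i \<in> definable \<and> X i \<noteq> {}) \<longrightarrow>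
        (\<forall>i. 1 \<le> i \<and> i \<le> k - 1 \<longrightarrow>
           bar (X i) (X (i - 1) \<union> X (i + 1)) \<inter> X (i - 1) \<noteq> {}) \<longrightarrow>
        bar (X k) (X (k - 1) \<union> X 0) \<inter> X (k - 1) \<noteq> {} \<longrightarrow>
        bar (X 0) (X k \<union> X 1) \<inter> X 1 \<noteq> {})"

end

theory Submission
  imports Defs
begin

text \<open>Soundness and completeness turn every syntactic notion into a statement about sets of models:
  a theory is consistent iff it has a model, its closure is the theory of its models, and \<^const>\<open>Con\<close>
  says that two model sets meet. So if \<open>*\<close> respects equivalence, \<open>M(T)|M(T') = M(T * T')\<close> is well
  defined, and conditions on \<open>*\<close> translate literally into conditions on \<open>|\<close>.

  In the other direction the theory \<open>T * T' = Th(M(T)|M(T'))\<close> does not determine \<open>Z = M(T)|M(T')\<close>, only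
  its closure \<open>M(Th(Z))\<close>, the least definable set that contains \<open>Z\<close>. Both \<open>(K*7)\<close> and \<open>(*Loop)\<close>
  look at \<open>Z\<close> only through its intersection with another model set \<open>B\<close>, so all that is needed is that
  \<open>M(Th(Z)) \<inter> B\<close> and \<open>Z \<inter> B\<close> have the same theory (in particular, that one is empty iff the
  other is). This is trivial if \<open>Z\<close> is definable. It is also true if \<open>B\<close> is the model set of one
  formula \<open>\<phi>\<close>: a formula \<open>\<psi>\<close> holds on \<open>Z \<inter> B\<close> iff \<open>\<phi> \<longrightarrow> \<psi>\<close> holds on \<open>Z\<close>, and
  \<open>Z\<close> and its closure have the same theory. The lemmas \<open>K7_instance_star_of\<close> and
  \<open>star_Loop_instance_star_of\<close> isolate this condition, and each covers two of the positive claims.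

  For the two negative claims a single operation suffices: with infinitely many variables, let
  \<open>X|Y\<close> avoid one fixed model \<open>m\<close> of \<open>Y\<close> whenever \<open>Y\<close> has another one. It selects the elements of
  \<open>Y\<close> of least rank when \<open>m\<close> is ranked above all other models, and therefore satisfies
  \<open>(X|7)\<close> and \<open>(|Loop)\<close>. But no formula isolates \<open>m\<close>, so \<open>m\<close> reappears in the closure of
  \<open>M\<^sub>\<L> - {m}\<close>, whereas it is lost for good when it is removed from a set of two models; both
  syntactic conditions compare these two situations.\<close>

section \<open>Soundness and completeness\<close>

lemma soundness:
  assumes "\<Gamma> \<turnstile> \<phi>" and "m \<in> Mod \<Gamma>"
  shows "m \<Turnstile> \<phi>"
  using assms by (induction rule: derives.induct) (auto simp: Mod_def)

lemma derives_mono: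
  assumes "\<Gamma> \<turnstile> \<phi>" and "\<Gamma> \<subseteq> \<Delta>"
  shows "\<Delta> \<turnstile> \<phi>"
  using assms
proof (induction arbitrary: \<Delta> rule: derives.induct)
  case (DisjE \<Gamma> \<phi> \<psi> \<chi>)
  then show ?case by (meson derives.DisjE insert_mono)
qed (blast intro: derives.intros insert_mono)+

lemma finite_support_insert:
  assumes "\<exists>F. finite F \<and> F \<subseteq> insert \<phi> \<Gamma> \<and> F \<turnstile> \<psi>"
  obtains F where "finite F" "F \<subseteq> \<Gamma>" "insert \<phi> F \<turnstile> \<psi>"
proof -
  from assms obtain F where F: "finite F" "F \<subseteq> insert \<phi> \<Gamma>" "F \<turnstile> \<psi>" by blast
  have "insert \<phi> (F - {\<phi>}) \<turnstile> \<psi>"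
    by (rule derives_mono[OF F(3)]) auto
  with F show ?thesis by (intro that[of "F - {\<phi>}"]) auto
qed

lemma derives_finite_support:
  assumes "\<Gamma> \<turnstile> \<phi>"
  shows "\<exists>F. finite F \<and> F \<subseteq> \<Gamma> \<and> F \<turnstile> \<phi>"
  using assms
proof (induction rule: derives.induct)
  case (Assm \<phi> \<Gamma>)
  then show ?case by (intro exI[of _ "{\<phi>}"]) (auto intro: derives.Assm)
next
  case (Classical \<phi> \<Gamma>)
  then show ?case by (meson finite_support_insert derives.Classical)
next
  case (NegI \<phi> \<Gamma>)
  then show ?case by (meson finite_support_insert derives.NegI)
next
  case (ImpI \<phi> \<Gamma> \<psi>)
  then show ?case by (meson finite_support_insert derives.ImpI)
next
  case (DisjE \<Gamma> \<phi> \<psi> \<chi>)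
  from DisjE.IH(1) obtain F where F: "finite F" "F \<subseteq> \<Gamma>" "F \<turnstile> Disj \<phi> \<psi>" by blast
  obtain G where G: "finite G" "G \<subseteq> \<Gamma>" "insert \<phi> G \<turnstile> \<chi>"
    using DisjE.IH(2) by (rule finite_support_insert)
  obtain H where H: "finite H" "H \<subseteq> \<Gamma>" "insert \<psi> H \<turnstile> \<chi>"
    using DisjE.IH(3) by (rule finite_support_insert)
  let ?U = "F \<union> G \<union> H"
  have "?U \<turnstile> Disj \<phi> \<psi>" "insert \<phi> ?U \<turnstile> \<chi>" "insert \<psi> ?U \<turnstile> \<chi>"
    by (rule derives_mono[OF F(3)] derives_mono[OF G(3)] derives_mono[OF H(3)]; blast)+
  then have "?U \<turnstile> \<chi>" by (rule derives.DisjE)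
  with F G H show ?case by (intro exI[of _ ?U]) auto
next
  case (NegE \<Gamma> \<phi>)
  then obtain F G where "finite F" "F \<subseteq> \<Gamma>" "F \<turnstile> Neg \<phi>" "finite G" "G \<subseteq> \<Gamma>" "G \<turnstile> \<phi>" by blast
  then show ?case
    by (intro exI[of _ "F \<union> G"]) (auto intro: derives.NegE derives_mono)
next
  case (ConjI \<Gamma> \<phi> \<psi>)
  then obtain F G where "finite F" "F \<subseteq> \<Gamma>" "F \<turnstile> \<phi>" "finite G" "G \<subseteq> \<Gamma>" "G \<turnstile> \<psi>" by blast
  then show ?case
    by (intro exI[of _ "F \<union> G"]) (auto intro: derives.ConjI derives_mono)
next
  case (ImpE \<Gamma> \<phi> \<psi>)
  then obtain F G where "finite F" "F \<subseteq> \<Gamma>" "F \<turnstile> Imp \<phi> \<psi>" "finite G" "G \<subseteq> \<Gamma>" "G \<turnstile> \<phi>" by blast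
  then show ?case
    by (intro exI[of _ "F \<union> G"]) (auto intro: derives.ImpE derives_mono)
qed (blast intro: derives.intros)+

text \<open>The language may be uncountable, so the maximal extension comes from Zorn's lemma instead of an
  enumeration of the formulas. A union of a chain is consistent because a refutation uses finitely
  many premises, which all lie in one member.\<close>

lemma consistent_extends_to_maximal:
  assumes "consistent T"
  obtains M where "T \<subseteq> M" "consistent M" "\<And>S. consistent S \<Longrightarrow> M \<subseteq> S \<Longrightarrow> S = M"
proof -
  let ?A = "{S. T \<subseteq> S \<and> consistent S}"
  have "\<exists>M\<in>?A. \<forall>S\<in>?A. M \<subseteq> S \<longrightarrow> S = M"
  proof (rule subset_Zorn_nonempty)
    show "?A \<noteq> {}" using assms by blast
  next
    fix C assume C: "C \<noteq> {}" "subset.chain ?A C"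
    have "consistent (\<Union>C)"
      unfolding consistent_def
    proof
      assume "\<Union>C \<turnstile> Falsum"
      then obtain F where F: "finite F" "F \<subseteq> \<Union>C" "F \<turnstile> Falsum"
        using derives_finite_support by blast
      obtain S where "S \<in> C" "F \<subseteq> S"
        using finite_subset_Union_chain[OF F(1,2) C] by blast
      then have "consistent S" "S \<turnstile> Falsum"
        using C(2) derives_mono[OF F(3)] by (auto simp: subset_chain_def)
      then show False by (simp add: consistent_def)
    qed
    moreover have "T \<subseteq> \<Union>C"
      using C unfolding subset_chain_def by blast
    ultimately show "\<Union>C \<in> ?A" by simp
  qed
  then obtain M where M: "T \<subseteq> M" "consistent M" and
    max: "\<forall>S\<in>?A. M \<subseteq> S \<longrightarrow> S = M" by blast
  show ?thesis
  proof (rule that[OF M])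
    fix S assume "consistent S" "M \<subseteq> S"
    with M(1) max show "S = M" by blast
  qed
qed

text \<open>In a maximal consistent set membership behaves like truth at the model that makes exactly its
  atoms true.\<close>

lemma consistent_imp_satisfiable:
  assumes "consistent T"
  shows "Mod T \<noteq> {}"
proof -
  obtain M where M: "T \<subseteq> M" "consistent M" and max: "\<And>S. consistent S \<Longrightarrow> M \<subseteq> S \<Longrightarrow> S = M"
    using consistent_extends_to_maximal[OF assms] by metis
  have neg: "M \<turnstile> Neg \<phi>" if "\<phi> \<notin> M" for \<phi>
  proof -
    have "\<not> consistent (insert \<phi> M)" using max[of "insert \<phi> M"] that by blast
    then show ?thesis by (auto simp: consistent_def intro: derives.NegI)
  qed
  have closed: "\<phi> \<in> M" if "M \<turnstile> \<phi>" for \<phi>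
    using neg[of \<phi>] derives.NegE that M(2) by (auto simp: consistent_def)
  have not_both: "\<not> (M \<turnstile> \<phi> \<and> M \<turnstile> Neg \<phi>)" for \<phi>
    using M(2) by (auto simp: consistent_def dest: derives.NegE)
  have mem_iff: "\<phi> \<in> M \<longleftrightarrow> M \<turnstile> \<phi>" for \<phi>
    using closed derives.Assm by blast
  have mem_Neg: "Neg \<phi> \<in> M \<longleftrightarrow> \<phi> \<notin> M" for \<phi>
    using neg not_both mem_iff by blast
  have mem_Conj: "Conj \<phi> \<psi> \<in> M \<longleftrightarrow> \<phi> \<in> M \<and> \<psi> \<in> M" for \<phi> \<psi>
    unfolding mem_iff by (blast intro: derives.intros)
  have mem_Disj: "Disj \<phi> \<psi> \<in> M \<longleftrightarrow> \<phi> \<in> M \<or> \<psi> \<in> M" for \<phi> \<psi>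
  proof
    assume D: "Disj \<phi> \<psi> \<in> M"
    show "\<phi> \<in> M \<or> \<psi> \<in> M"
    proof (rule ccontr)
      assume "\<not> (\<phi> \<in> M \<or> \<psi> \<in> M)"
      then have "M \<turnstile> Neg \<phi>" "M \<turnstile> Neg \<psi>" using neg by auto
      then have "insert \<phi> M \<turnstile> Falsum" "insert \<psi> M \<turnstile> Falsum"
        by (meson derives.NegE derives.Assm derives_mono insertI1 subset_insertI)+
      with D have "M \<turnstile> Falsum" unfolding mem_iff by (rule derives.DisjE)
      with M(2) show False by (simp add: consistent_def)
    qed
  qed (auto simp: mem_iff intro: derives.intros)
  have mem_Imp: "Imp \<phi> \<psi> \<in> M \<longleftrightarrow> (\<phi> \<in> M \<longrightarrow> \<psi> \<in> M)" for \<phi> \<psi>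
  proof
    assume imp: "\<phi> \<in> M \<longrightarrow> \<psi> \<in> M"
    have "insert \<phi> M \<turnstile> \<psi>"
    proof (cases "\<phi> \<in> M")
      case True
      with imp show ?thesis by (auto intro: derives.Assm)
    next
      case False
      then have "insert (Neg \<psi>) (insert \<phi> M) \<turnstile> Neg \<phi>"
        by (intro derives_mono[OF neg]) auto
      then have "insert (Neg \<psi>) (insert \<phi> M) \<turnstile> Falsum"
        by (rule derives.NegE) (auto intro: derives.Assm)
      then show ?thesis by (rule derives.Classical)
    qed
    then show "Imp \<phi> \<psi> \<in> M" unfolding mem_iff by (rule derives.ImpI)
  qed (auto simp: mem_iff intro: derives.ImpE)
  have "Falsum \<notin> M"
    using M(2) by (simp add: mem_iff consistent_def)
  then have "(\<lambda>p. Atom p \<in> M) \<Turnstile> \<phi> \<longleftrightarrow> \<phi> \<in> M" for \<phi>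
    by (induction \<phi>) (simp_all add: mem_Neg mem_Conj mem_Disj mem_Imp)
  with M(1) have "(\<lambda>p. Atom p \<in> M) \<in> Mod T" by (auto simp: Mod_def)
  then show ?thesis by blast
qed

lemma consistent_iff_satisfiable: "consistent T \<longleftrightarrow> Mod T \<noteq> {}"
  using consistent_imp_satisfiable soundness by (fastforce simp: consistent_def)

lemma Cn_eq_Th_Mod: "Cn T = Th (Mod T)"
proof -
  have "T \<turnstile> \<phi>" if "\<forall>m\<in>Mod T. m \<Turnstile> \<phi>" for \<phi>
  proof -
    have "Mod (insert (Neg \<phi>) T) = {}" using that by (auto simp: Mod_def)
    then have "insert (Neg \<phi>) T \<turnstile> Falsum"
      using consistent_imp_satisfiable consistent_def by blast
    then show ?thesis by (rule derives.Classical)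
  qed
  then show ?thesis using soundness by (fastforce simp: Cn_def Th_def)
qed

section \<open>The connection between theories and sets of models\<close>

lemma Mod_Un: "Mod (S \<union> T) = Mod S \<inter> Mod T"
  by (auto simp: Mod_def)

lemma Mod_disj_theory: "Mod (disj_theory S T) = Mod S \<union> Mod T"
  by (fastforce simp: Mod_def disj_theory_def)

lemma Mod_Th_Mod: "Mod (Th (Mod T)) = Mod T"
  by (auto simp: Mod_def Th_def)

lemma subset_Mod_Th: "Z \<subseteq> Mod (Th Z)"
  by (auto simp: Mod_def Th_def)

lemma Mod_in_definable: "Mod T \<in> definable"
  by (simp add: definable_def)

lemma Mod_Th_definable: "Z \<in> definable \<Longrightarrow> Mod (Th Z) = Z"
  by (auto simp: definable_def Mod_Th_Mod)

lemma Con_iff: "Con S T \<longleftrightarrow> Mod S \<inter> Mod T \<noteq> {}"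
  by (simp add: Con_def consistent_iff_satisfiable Mod_Un)

lemma Falsum_in_Th_iff: "Falsum \<in> Th Z \<longleftrightarrow> Z = {}"
  by (auto simp: Th_def)

lemma K7_instance_iff:
  "K7_instance star T T' T'' \<longleftrightarrow>
     (Mod T \<noteq> {} \<longrightarrow> Mod T' \<inter> Mod T'' \<noteq> {} \<longrightarrow>
        star T (T' \<union> T'') \<subseteq> Th (Mod (star T T') \<inter> Mod T''))"
  unfolding K7_instance_def consistent_iff_satisfiable Cn_eq_Th_Mod Mod_Un by blast

lemma star_Loop_instance_iff:
  "star_Loop_instance star k T \<longleftrightarrow>
     ((\<forall>i\<le>k. Mod (T i) \<noteq> {}) \<longrightarrow>
      (\<forall>i. 1 \<le> i \<and> i \<le> k - 1 \<longrightarrow>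
         Mod (star (T i) (disj_theory (T (i - 1)) (T (i + 1)))) \<inter> Mod (T (i - 1)) \<noteq> {}) \<longrightarrow>
      Mod (star (T k) (disj_theory (T (k - 1)) (T 0))) \<inter> Mod (T (k - 1)) \<noteq> {} \<longrightarrow>
      Mod (star (T 0) (disj_theory (T k) (T 1))) \<inter> Mod (T 1) \<noteq> {})"
  unfolding star_Loop_instance_def consistent_iff_satisfiable Con_iff by (simp add: Int_commute)

section \<open>From syntactic to semantic operations\<close>

text \<open>Theories with the same models have the same deductive closure by completeness, so the set
  described by \<^const>\<open>bar_of\<close> does not depend on the representing theories.\<close>

lemma bar_of_Mod:
  assumes resp: "respects_equivalence star" and ne: "Mod T \<noteq> {}" "Mod T' \<noteq> {}"
  shows "bar_of star (Mod T) (Mod T') = Mod (star T T')"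
  unfolding bar_of_def
proof (rule the_equality)
  show "\<exists>S S'. consistent S \<and> consistent S' \<and> Mod T = Mod S \<and> Mod T' = Mod S' \<and>
          Mod (star T T') = Mod (star S S')"
    using ne consistent_iff_satisfiable by blast
next
  fix Z
  assume "\<exists>S S'. consistent S \<and> consistent S' \<and> Mod T = Mod S \<and> Mod T' = Mod S' \<and>
            Z = Mod (star S S')"
  then obtain S S' where S: "consistent S" "consistent S'" "Mod T = Mod S" "Mod T' = Mod S'"
    "Z = Mod (star S S')" by blast
  moreover have "Cn S = Cn T" "Cn S' = Cn T'"
    using S by (simp_all add: Cn_eq_Th_Mod)
  moreover have "consistent T" "consistent T'"
    using ne by (simp_all add: consistent_iff_satisfiable)
  ultimately have "star S S' = star T T'"
    using resp unfolding respects_equivalence_def by blast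
  with S show "Z = Mod (star T T')" by simp
qed

lemma X7_bar_of:
  assumes resp: "respects_equivalence star" and "K7 star"
  shows "X7 (bar_of star)"
  unfolding X7_def
proof (intro ballI impI)
  fix X A B :: "'a model set"
  assume "X \<in> definable" "A \<in> definable" "B \<in> definable"
  then obtain T T' T'' where T: "X = Mod T" "A = Mod T'" "B = Mod T''"
    by (auto simp: definable_def)
  assume ne: "X \<noteq> {}" "A \<noteq> {}" "A \<inter> B \<noteq> {}"
  have "K7_instance star T T' T''"
    using assms(2) by (simp add: K7_def)
  then have "star T (T' \<union> T'') \<subseteq> Th (Mod (star T T') \<inter> Mod T'')"
    using ne by (simp add: K7_instance_iff T)
  then have "Mod (star T T') \<inter> Mod T'' \<subseteq> Mod (star T (T' \<union> T''))"
    by (auto simp: Mod_def Th_def)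
  moreover have "bar_of star X A = Mod (star T T')"
    using bar_of_Mod[OF resp] ne by (simp add: T)
  moreover have "bar_of star X (A \<inter> B) = Mod (star T (T' \<union> T''))"
    using bar_of_Mod[OF resp, of T "T' \<union> T''"] ne by (simp add: T Mod_Un)
  ultimately show "bar_of star X A \<inter> B \<subseteq> bar_of star X (A \<inter> B)"
    by (simp add: T)
qed

lemma bar_Loop_bar_of:
  fixes star :: "'v revision"
  assumes resp: "respects_equivalence star" and loop: "star_Loop star"
  shows "bar_Loop (bar_of star)"
  unfolding bar_Loop_def
proof (intro allI impI)
  fix k :: nat and X :: "nat \<Rightarrow> 'v model set"
  assume k: "1 \<le> k"
    and X: "\<forall>i\<le>k. X i \<in> definable \<and> X i \<noteq> {}"
    and step: "\<forall>i. 1 \<le> i \<and> i \<le> k - 1 \<longrightarrow>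
           bar_of star (X i) (X (i - 1) \<union> X (i + 1)) \<inter> X (i - 1) \<noteq> {}"
    and last: "bar_of star (X k) (X (k - 1) \<union> X 0) \<inter> X (k - 1) \<noteq> {}"
  have "\<forall>i. \<exists>T. i \<le> k \<longrightarrow> X i = Mod T"
    using X by (auto simp: definable_def)
  then obtain T where T: "\<And>i. i \<le> k \<Longrightarrow> X i = Mod (T i)" by metis
  have bar: "bar_of star (X i) (X j \<union> X l) = Mod (star (T i) (disj_theory (T j) (T l)))"
    if "i \<le> k" "j \<le> k" "l \<le> k" for i j l
    using bar_of_Mod[OF resp, of "T i" "disj_theory (T j) (T l)"] X that
    by (auto simp: T Mod_disj_theory)
  have "star_Loop_instance star k T"
    using loop k by (simp add: star_Loop_def)
  moreover have "\<forall>i\<le>k. Mod (T i) \<noteq> {}"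
    using X T by metis
  moreover have "\<forall>i. 1 \<le> i \<and> i \<le> k - 1 \<longrightarrow>
         Mod (star (T i) (disj_theory (T (i - 1)) (T (i + 1)))) \<inter> Mod (T (i - 1)) \<noteq> {}"
  proof (intro allI impI)
    fix i assume i: "1 \<le> i \<and> i \<le> k - 1"
    then have "i \<le> k" "i - 1 \<le> k" "i + 1 \<le> k" using k by linarith+
    then show "Mod (star (T i) (disj_theory (T (i - 1)) (T (i + 1)))) \<inter> Mod (T (i - 1)) \<noteq> {}"
      using step i bar T by metis
  qed
  moreover have "Mod (star (T k) (disj_theory (T (k - 1)) (T 0))) \<inter> Mod (T (k - 1)) \<noteq> {}"
    using last bar[of k "k - 1" 0] T[of "k - 1"] by simp
  ultimately have "Mod (star (T 0) (disj_theory (T k) (T 1))) \<inter> Mod (T 1) \<noteq> {}"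
    unfolding star_Loop_instance_iff by blast
  then show "bar_of star (X 0) (X k \<union> X 1) \<inter> X 1 \<noteq> {}"
    using bar[of 0 k 1] T[of 1] k by simp
qed

section \<open>From semantic to syntactic operations\<close>

text \<open>The deduction theorem in semantic form: truth of \<open>\<psi>\<close> on the models of \<open>\<phi>\<close> in a set is truth of
  \<open>\<phi> \<longrightarrow> \<psi>\<close> on the whole set, which is the same for the set and for its closure.\<close>

lemma Th_closure_Int_formula: "Th (Mod (Th Z) \<inter> Mod {\<phi>}) = Th (Z \<inter> Mod {\<phi>})"
proof
  show "Th (Mod (Th Z) \<inter> Mod {\<phi>}) \<subseteq> Th (Z \<inter> Mod {\<phi>})"
    using subset_Mod_Th by (fastforce simp: Th_def)
next
  show "Th (Z \<inter> Mod {\<phi>}) \<subseteq> Th (Mod (Th Z) \<inter> Mod {\<phi>})"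
  proof
    fix \<psi> assume "\<psi> \<in> Th (Z \<inter> Mod {\<phi>})"
    then have "Imp \<phi> \<psi> \<in> Th Z" by (auto simp: Th_def Mod_def)
    then have "\<forall>m\<in>Mod (Th Z). m \<Turnstile> Imp \<phi> \<psi>" unfolding Mod_def by blast
    then show "\<psi> \<in> Th (Mod (Th Z) \<inter> Mod {\<phi>})" by (auto simp: Th_def Mod_def)
  qed
qed

lemma K7_instance_star_of:
  assumes "X7 bar"
    and closure: "Mod T \<noteq> {} \<Longrightarrow> Mod T' \<noteq> {} \<Longrightarrow>
      Th (Mod (Th (bar (Mod T) (Mod T'))) \<inter> Mod T'') = Th (bar (Mod T) (Mod T') \<inter> Mod T'')"
  shows "K7_instance (star_of bar) T T' T''"
  unfolding K7_instance_iff star_of_def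
proof (intro impI)
  assume ne: "Mod T \<noteq> {}" "Mod T' \<inter> Mod T'' \<noteq> {}"
  then have ne': "Mod T' \<noteq> {}" by blast
  have "bar (Mod T) (Mod T') \<inter> Mod T'' \<subseteq> bar (Mod T) (Mod T' \<inter> Mod T'')"
    using assms(1) ne ne' Mod_in_definable unfolding X7_def by blast
  then have "Th (bar (Mod T) (Mod (T' \<union> T''))) \<subseteq> Th (bar (Mod T) (Mod T') \<inter> Mod T'')"
    by (auto simp: Mod_Un Th_def)
  then show "Th (bar (Mod T) (Mod (T' \<union> T'')))
      \<subseteq> Th (Mod (Th (bar (Mod T) (Mod T'))) \<inter> Mod T'')"
    using closure ne ne' by simp
qed

lemma star_Loop_instance_star_of:
  assumes loop: "bar_Loop bar" and k: "1 \<le> k"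
    and closure: "\<And>i j l. i \<le> k \<Longrightarrow> j \<le> k \<Longrightarrow> l \<le> k \<Longrightarrow>
      Mod (T i) \<noteq> {} \<Longrightarrow> Mod (T j) \<noteq> {} \<Longrightarrow> Mod (T l) \<noteq> {} \<Longrightarrow>
      Th (Mod (Th (bar (Mod (T i)) (Mod (T j) \<union> Mod (T l)))) \<inter> Mod (T j))
        = Th (bar (Mod (T i)) (Mod (T j) \<union> Mod (T l)) \<inter> Mod (T j))"
  shows "star_Loop_instance (star_of bar) k T"
  unfolding star_Loop_instance_iff star_of_def Mod_disj_theory
proof (intro impI)
  assume ne: "\<forall>i\<le>k. Mod (T i) \<noteq> {}"
    and step: "\<forall>i. 1 \<le> i \<and> i \<le> k - 1 \<longrightarrow>
      Mod (Th (bar (Mod (T i)) (Mod (T (i - 1)) \<union> Mod (T (i + 1))))) \<inter> Mod (T (i - 1)) \<noteq> {}"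
    and last: "Mod (Th (bar (Mod (T k)) (Mod (T (k - 1)) \<union> Mod (T 0)))) \<inter> Mod (T (k - 1)) \<noteq> {}"
  have meets: "bar (Mod (T i)) (Mod (T j) \<union> Mod (T l)) \<inter> Mod (T j) \<noteq> {}"
    if "i \<le> k" "j \<le> k" "l \<le> k"
      "Mod (Th (bar (Mod (T i)) (Mod (T j) \<union> Mod (T l)))) \<inter> Mod (T j) \<noteq> {}" for i j l
    using closure[of i j l] ne that Falsum_in_Th_iff by metis
  have "\<forall>i. 1 \<le> i \<and> i \<le> k - 1 \<longrightarrow>
      bar (Mod (T i)) (Mod (T (i - 1)) \<union> Mod (T (i + 1))) \<inter> Mod (T (i - 1)) \<noteq> {}"
  proof (intro allI impI)
    fix i assume i: "1 \<le> i \<and> i \<le> k - 1"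
    then have "i \<le> k" "i - 1 \<le> k" "i + 1 \<le> k" using k by linarith+
    then show "bar (Mod (T i)) (Mod (T (i - 1)) \<union> Mod (T (i + 1))) \<inter> Mod (T (i - 1)) \<noteq> {}"
      using meets step[rule_format, OF i] by simp
  qed
  moreover have "bar (Mod (T k)) (Mod (T (k - 1)) \<union> Mod (T 0)) \<inter> Mod (T (k - 1)) \<noteq> {}"
    using meets last by simp
  moreover have "\<forall>i\<le>k. Mod (T i) \<in> definable \<and> Mod (T i) \<noteq> {}"
    using ne Mod_in_definable by blast
  ultimately have "bar (Mod (T 0)) (Mod (T k) \<union> Mod (T 1)) \<inter> Mod (T 1) \<noteq> {}"
    using loop[unfolded bar_Loop_def, rule_format, OF k, of "\<lambda>i. Mod (T i)"] by simp
  then show "Mod (Th (bar (Mod (T 0)) (Mod (T k) \<union> Mod (T 1)))) \<inter> Mod (T 1) \<noteq> {}"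
    using subset_Mod_Th by fast
qed

lemma K7_star_of_mu_dp:
  assumes "X7 bar" and "mu_dp bar"
  shows "K7 (star_of bar)"
  unfolding K7_def
proof (intro allI)
  fix T T' T''
  show "K7_instance (star_of bar) T T' T''"
  proof (rule K7_instance_star_of[OF assms(1)])
    assume "Mod T \<noteq> {}" "Mod T' \<noteq> {}"
    then have "bar (Mod T) (Mod T') \<in> definable"
      using assms(2) Mod_in_definable unfolding mu_dp_def by blast
    then show "Th (Mod (Th (bar (Mod T) (Mod T'))) \<inter> Mod T'')
        = Th (bar (Mod T) (Mod T') \<inter> Mod T'')"
      by (simp add: Mod_Th_definable)
  qed
qed

lemma K7_instance_star_of_formula:
  assumes "X7 bar" and "Mod T'' = Mod {\<phi>}"
  shows "K7_instance (star_of bar) T T' T''"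
  using assms by (intro K7_instance_star_of) (simp_all add: Th_closure_Int_formula)

lemma star_Loop_star_of_mu_dp:
  assumes "bar_Loop bar" and "mu_dp bar"
  shows "star_Loop (star_of bar)"
  unfolding star_Loop_def
proof (intro allI impI)
  fix k :: nat and T assume k: "1 \<le> k"
  show "star_Loop_instance (star_of bar) k T"
  proof (rule star_Loop_instance_star_of[OF assms(1) k])
    fix i j l
    assume "Mod (T i) \<noteq> {}" "Mod (T j) \<noteq> {}"
    moreover have "Mod (T j) \<union> Mod (T l) \<in> definable"
      using Mod_in_definable[of "disj_theory (T j) (T l)"] by (simp add: Mod_disj_theory)
    ultimately have "bar (Mod (T i)) (Mod (T j) \<union> Mod (T l)) \<in> definable"
      using assms(2) Mod_in_definable unfolding mu_dp_def by blast
    then show "Th (Mod (Th (bar (Mod (T i)) (Mod (T j) \<union> Mod (T l)))) \<inter> Mod (T j))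
        = Th (bar (Mod (T i)) (Mod (T j) \<union> Mod (T l)) \<inter> Mod (T j))"
      by (simp add: Mod_Th_definable)
  qed
qed

lemma star_Loop_instance_star_of_formula:
  assumes "bar_Loop bar" and "1 \<le> k" and formula: "\<forall>i\<le>k. \<exists>\<phi>. Mod (T i) = Mod {\<phi>}"
  shows "star_Loop_instance (star_of bar) k T"
proof (rule star_Loop_instance_star_of[OF assms(1,2)])
  fix i j l :: nat
  assume "j \<le> k"
  then obtain \<phi> where "Mod (T j) = Mod {\<phi>}" using formula by blast
  then show "Th (Mod (Th (bar (Mod (T i)) (Mod (T j) \<union> Mod (T l)))) \<inter> Mod (T j))
      = Th (bar (Mod (T i)) (Mod (T j) \<union> Mod (T l)) \<inter> Mod (T j))"
    by (simp add: Th_closure_Int_formula)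
qed

section \<open>An operation with both semantic conditions and neither syntactic one\<close>

definition avoid :: "'v model \<Rightarrow> 'v sem_op" where
  "avoid m X Y = (if Y = {m} then Y else Y - {m})"

lemma avoid_eq_Diff: "m' \<in> Y \<Longrightarrow> m' \<noteq> m \<Longrightarrow> avoid m X Y = Y - {m}"
  by (auto simp: avoid_def)

lemma avoid_pair: "m \<noteq> m' \<Longrightarrow> avoid m X {m, m'} = {m'}"
  by (auto simp: avoid_def)

lemma X7_avoid: "X7 (avoid m)"
  by (auto simp: X7_def avoid_def)

text \<open>With \<open>m\<close> ranked above all other models, \<open>{m}\<close> is the only set of high rank among the nonempty
  ones. This equivalence then says that the selected elements of \<open>A \<union> B\<close> include some of \<open>A\<close> iff the
  rank of \<open>A\<close> is at most the rank of \<open>B\<close>.\<close>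

lemma avoid_meets_left_iff:
  assumes "A \<noteq> {}" and "B \<noteq> {}"
  shows "avoid m X (A \<union> B) \<inter> A \<noteq> {} \<longleftrightarrow> (A = {m} \<longrightarrow> B = {m})"
  using assms by (auto simp: avoid_def)

lemma step_two_chain:
  fixes P :: "nat \<Rightarrow> bool"
  assumes step: "\<And>i. i + 2 \<le> k \<Longrightarrow> P i \<Longrightarrow> P (i + 2)"
  shows "i + 2 * n \<le> k \<Longrightarrow> P i \<Longrightarrow> P (i + 2 * n)"
proof (induction n)
  case (Suc n)
  then have "P (i + 2 * n)" by simp
  then show ?case using step[of "i + 2 * n"] Suc.prems(1) by simp
qed simp

text \<open>The premises bound the rank of each \<open>X\<^sub>i\<close> by that of \<open>X\<^sub>i\<^sub>+\<^sub>2\<close>. For odd \<open>k\<close> this chain leads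
  from \<open>X\<^sub>1\<close> to \<open>X\<^sub>k\<close>. For even \<open>k\<close> it leads from \<open>X\<^sub>1\<close> to \<open>X\<^sub>k\<^sub>-\<^sub>1\<close>, the last premise continues it to
  \<open>X\<^sub>0\<close>, and the even indices lead from there to \<open>X\<^sub>k\<close>.\<close>

lemma bar_Loop_avoid:
  fixes m :: "'v model"
  shows "bar_Loop (avoid m)"
  unfolding bar_Loop_def
proof (intro allI impI)
  fix k :: nat and X :: "nat \<Rightarrow> 'v model set"
  assume k: "1 \<le> k"
    and X: "\<forall>i\<le>k. X i \<in> definable \<and> X i \<noteq> {}"
    and step: "\<forall>i. 1 \<le> i \<and> i \<le> k - 1 \<longrightarrow>
           avoid m (X i) (X (i - 1) \<union> X (i + 1)) \<inter> X (i - 1) \<noteq> {}"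
    and last: "avoid m (X k) (X (k - 1) \<union> X 0) \<inter> X (k - 1) \<noteq> {}"
  have chain: "X (i + 2) = {m}" if "i + 2 \<le> k" "X i = {m}" for i
  proof -
    have meets: "avoid m (X (i + 1)) (X i \<union> X (i + 2)) \<inter> X i \<noteq> {}"
      using step[rule_format, of "i + 1"] that(1) by simp
    have "X i \<noteq> {}" "X (i + 2) \<noteq> {}" using X that(1) by simp_all
    from avoid_meets_left_iff[OF this] meets that(2) show ?thesis by (rule iffD1[THEN mp])
  qed
  have around: "X (k - 1) = {m} \<longrightarrow> X 0 = {m}"
    using last X by (simp add: avoid_meets_left_iff)
  have climb: "X (i + 2 * n) = {m}" if "i + 2 * n \<le> k" "X i = {m}" for i n
    using step_two_chain[of k "\<lambda>i. X i = {m}", OF chain] that by blast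
  have "X k = {m}" if "X 1 = {m}"
  proof (cases "odd k")
    case True
    then obtain n where n: "k = 2 * n + 1" by (auto elim: oddE)
    with climb[of 1 n] that show ?thesis by simp
  next
    case False
    then obtain n where n: "k = 2 * n" by (auto elim: evenE)
    then have "X (k - 1) = {m}"
      using climb[of 1 "n - 1"] that k by (cases n) auto
    with around climb[of 0 n] n show ?thesis by simp
  qed
  moreover have "avoid m (X 0) (X 1 \<union> X k) \<inter> X 1 \<noteq> {} \<longleftrightarrow> (X 1 = {m} \<longrightarrow> X k = {m})"
    using X k by (intro avoid_meets_left_iff) auto
  ultimately show "avoid m (X 0) (X k \<union> X 1) \<inter> X 1 \<noteq> {}"
    by (simp add: Un_commute)
qed

lemma sat_cong:
  assumes "\<And>p. p \<in> set_form \<phi> \<Longrightarrow> m p = m' p"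
  shows "m \<Turnstile> \<phi> \<longleftrightarrow> m' \<Turnstile> \<phi>"
  using assms by (induction \<phi>) auto

lemma finite_set_form: "finite (set_form \<phi>)"
  by (induction \<phi>) auto

text \<open>A formula mentions finitely many variables, so it cannot tell \<open>m\<close> from a model that differs from
  \<open>m\<close> at a variable outside the formula.\<close>

lemma point_in_closure_of_rest:
  fixes m :: "'v model"
  assumes inf: "infinite (UNIV :: 'v set)"
  shows "Mod (Th (UNIV - {m})) = UNIV"
proof -
  have "m \<Turnstile> \<phi>" if \<phi>: "\<phi> \<in> Th (UNIV - {m})" for \<phi>
  proof -
    obtain p where p: "p \<notin> set_form \<phi>"
      using ex_new_if_finite[OF inf finite_set_form] by blast
    let ?m' = "m(p := \<not> m p)"
    have "?m' \<noteq> m" by (metis fun_upd_same)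
    with \<phi> have "?m' \<Turnstile> \<phi>" by (simp add: Th_def)
    moreover have "?m' \<Turnstile> \<phi> \<longleftrightarrow> m \<Turnstile> \<phi>" by (rule sat_cong) (use p in auto)
    ultimately show ?thesis by simp
  qed
  then have "m \<in> Mod (Th (UNIV - {m}))" by (simp add: Mod_def)
  then show ?thesis using subset_Mod_Th[of "UNIV - {m}"] by blast
qed

abbreviation all_true :: "'v model" where
  "all_true \<equiv> \<lambda>_. True"

abbreviation all_false :: "'v model" where
  "all_false \<equiv> \<lambda>_. False"

lemma Mod_atoms: "Mod (range Atom) = {all_true}"
  by (auto simp: Mod_def)

lemma Mod_negated_atoms: "Mod (range (\<lambda>p. Neg (Atom p))) = {all_false}"
  by (auto simp: Mod_def)

lemma Mod_constant: "Mod (range (\<lambda>(p, q :: 'v). Imp (Atom p) (Atom q))) = {all_true, all_false}"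
proof
  show "Mod (range (\<lambda>(p, q :: 'v). Imp (Atom p) (Atom q))) \<subseteq> {all_true, all_false}"
  proof
    fix m assume "m \<in> Mod (range (\<lambda>(p, q :: 'v). Imp (Atom p) (Atom q)))"
    then have "m p \<longrightarrow> m q" for p q by (force simp: Mod_def)
    then show "m \<in> {all_true, all_false}" by (cases "\<exists>p. m p") (auto simp: fun_eq_iff)
  qed
qed (auto simp: Mod_def)

lemma all_true_neq_all_false: "(all_true :: 'v model) \<noteq> all_false"
  by (simp add: fun_eq_iff)

text \<open>Revising by the whole space gives a theory whose closure contains the avoided model again, so
  adding the theory of the two constant models keeps both of them. Revising by that theory at once
  leaves only the other one, where every atom is false.\<close>

lemma not_K7_star_of_avoid:
  assumes inf: "infinite (UNIV :: 'v set)"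
  shows "\<not> K7 (star_of (avoid (all_true :: 'v model)))"
proof
  let ?C = "range (\<lambda>(p, q :: 'v). Imp (Atom p) (Atom q))"
  let ?a = "avoid (all_true :: 'v model)"
  fix p :: 'v
  assume "K7 (star_of ?a)"
  then have "K7_instance (star_of ?a) {} {} ?C" by (simp add: K7_def)
  moreover have "Mod {} = (UNIV :: 'v model set)" by (simp add: Mod_def)
  moreover have "?a UNIV UNIV = UNIV - {all_true}"
    using all_true_neq_all_false[where 'v = 'v] by (intro avoid_eq_Diff[of all_false]) auto
  moreover have "?a UNIV {all_true, all_false} = {all_false}"
    by (rule avoid_pair[OF all_true_neq_all_false])
  ultimately have "Th {all_false :: 'v model} \<subseteq> Th {all_true, all_false}"
    by (simp add: K7_instance_iff star_of_def Mod_constant point_in_closure_of_rest[OF inf])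
  moreover have "Neg (Atom p) \<in> Th {all_false}" "Neg (Atom p) \<notin> Th {all_true, all_false}"
    by (simp_all add: Th_def)
  ultimately show False by blast
qed

text \<open>The loop passes through all models, the avoided model and the constantly false model. The
  premise on the avoided model holds only because it lies in the closure of the other models; in the
  conclusion it competes with a single model, and a singleton is closed.\<close>

lemma not_star_Loop_star_of_avoid:
  assumes inf: "infinite (UNIV :: 'v set)"
  shows "\<not> star_Loop (star_of (avoid (all_true :: 'v model)))"
proof
  let ?a = "avoid (all_true :: 'v model)"
  define T :: "nat \<Rightarrow> 'v form set" where
    "T = (\<lambda>i. if i = 0 then {} else if i = 1 then range Atom else range (\<lambda>p. Neg (Atom p)))"
  have T: "Mod (T 0) = UNIV" "Mod (T 1) = {all_true}" "Mod (T 2) = {all_false}"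
    by (simp_all add: T_def Mod_atoms Mod_negated_atoms, simp add: Mod_def)
  assume "star_Loop (star_of ?a)"
  then have inst: "star_Loop_instance (star_of ?a) 2 T" by (simp add: star_Loop_def)
  have "?a X UNIV = UNIV - {all_true}" for X
    using all_true_neq_all_false[where 'v = 'v] by (intro avoid_eq_Diff[of all_false]) auto
  then have whole: "Mod (Th (?a X UNIV)) = UNIV" for X
    by (simp add: point_in_closure_of_rest[OF inf])
  have "?a UNIV {all_true, all_false} = {all_false}"
    by (rule avoid_pair[OF all_true_neq_all_false])
  then have pair: "Mod (Th (?a UNIV {all_true, all_false})) = {all_false}"
    using Mod_Th_Mod[of "T 2"] by (simp add: T)
  have "Mod (T i) \<noteq> {}" for i
    by (simp add: T_def Mod_atoms Mod_negated_atoms) (simp add: Mod_def)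
  moreover have "Mod (star_of ?a (T i) (disj_theory (T (i - 1)) (T (i + 1)))) \<inter> Mod (T (i - 1)) \<noteq> {}"
    if "1 \<le> i \<and> i \<le> 2 - 1" for i
  proof -
    have "i = 1" using that by simp
    moreover have "Mod (T (1 - 1)) = UNIV" using T(1) by simp
    ultimately show ?thesis by (simp add: star_of_def Mod_disj_theory T(1) whole)
  qed
  moreover have "Mod (star_of ?a (T 2) (disj_theory (T (2 - 1)) (T 0))) \<inter> Mod (T (2 - 1)) \<noteq> {}"
    using T(2) by (simp add: star_of_def Mod_disj_theory T whole)
  ultimately have "Mod (star_of ?a (T 0) (disj_theory (T 2) (T 1))) \<inter> Mod (T 1) \<noteq> {}"
    using inst unfolding star_Loop_instance_iff by blast
  moreover have "Mod (star_of ?a (T 0) (disj_theory (T 2) (T 1))) = {all_false}"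
    using T(2) by (simp add: star_of_def Mod_disj_theory T pair)
  ultimately show False
    using T(2) all_true_neq_all_false[where 'v = 'v] by auto
qed

section \<open>The correspondence\<close>

theorem proposition5p5:
  "(\<forall>star :: 'v revision. respects_equivalence star \<longrightarrow> K7 star \<longrightarrow> X7 (bar_of star))
 \<and> (\<forall>bar :: 'v sem_op. X7 bar \<longrightarrow> mu_dp bar \<longrightarrow> K7 (star_of bar))
 \<and> (\<forall>bar :: 'v sem_op. X7 bar \<longrightarrow>
      (\<forall>T T' T''. (\<exists>\<phi>. Mod T'' = Mod {\<phi>}) \<longrightarrow> K7_instance (star_of bar) T T' T''))
 \<and> (\<exists>bar :: nat sem_op. X7 bar \<and> \<not> K7 (star_of bar))
 \<and> (\<forall>star :: 'v revision. respects_equivalence star \<longrightarrow> star_Loop star \<longrightarrow> bar_Loop (bar_of star))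
 \<and> (\<forall>bar :: 'v sem_op. bar_Loop bar \<longrightarrow> mu_dp bar \<longrightarrow> star_Loop (star_of bar))
 \<and> (\<forall>bar :: 'v sem_op. bar_Loop bar \<longrightarrow>
      (\<forall>k\<ge>1. \<forall>T. (\<forall>i\<le>k. \<exists>\<phi>. Mod (T i) = Mod {\<phi>}) \<longrightarrow> star_Loop_instance (star_of bar) k T))
 \<and> (\<exists>bar :: nat sem_op. bar_Loop bar \<and> \<not> star_Loop (star_of bar))"
proof (intro conjI)
  show "\<exists>bar :: nat sem_op. X7 bar \<and> \<not> K7 (star_of bar)"
    using X7_avoid not_K7_star_of_avoid[OF infinite_UNIV_nat] by blast
  show "\<exists>bar :: nat sem_op. bar_Loop bar \<and> \<not> star_Loop (star_of bar)"
    using bar_Loop_avoid not_star_Loop_star_of_avoid[OF infinite_UNIV_nat] by blast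
qed (blast intro: X7_bar_of K7_star_of_mu_dp K7_instance_star_of_formula bar_Loop_bar_of
       star_Loop_star_of_mu_dp star_Loop_instance_star_of_formula)+

end
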